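(* For all integers $t\ge 0$ and $n\ge 1$, the following identity of rational functions in $x$ holds: $$\underline{N}^{(t)}_{n+1}(x)=\frac{a_0+a_1x+a_2x^2}{(n+t+3)(n+1)(c_0+c_1x)}\,\underline{N}^{(t)}_{n}(x)-\frac{n(n+t)(x-1)^2(b_0+b_1x)}{(n+t+3)(n+1)(c_0+c_1x)}\,\underline{N}^{(t)}_{n-1}(x),$$ where $$\begin{aligned} a_0&=-\bigl(2n^3+(2t+5)n^2+(2t+3)n\bigr),\\ a_1&=2t(t+2)n^3+3t(t+2)^2n^2+t(t+2)(t^2+5t+5)n+\tfrac12 t(t+1)(t+2)(t+3),\\ a_2&=(t+1)\Bigl((2t+2)n^3+(3t^2+9t+5)n^2+(2t+3)(t^2+3t+1)n+\tfrac12 t(t+1)(t+2)(t+3)\Bigr),\\ b_0&=-(n+1),\\ b_1&=(t+1)^2n+\tfrac12(t+1)(t^2+4t+2),\\ c_0&=-n,\\ c_1&=(t+1)^2n+\tfrac12 t(t+1)(t+2). \end{aligned}$$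
   Context: For nonnegative integers $n,m$ let $$N_{n,m}(x)=\sum_{k=0}^{n}\left(\binom{n}{k}\binom{m}{k}-\binom{n}{k+1}\binom{m}{k-1}\right)x^k,$$ where $\binom{a}{b}=0$ if $b<0$ or $b>a$. For nonnegative integers $t$ and $n$, put $\underline{N}^{(t)}_n(x)=N_{n,n+t}(x)$. *)

theory Defs
  imports "HOL-Computational_Algebra.Computational_Algebra"
begin

(* The lower index is an integer because k - 1 occurs below with k = 0, where truncated
   subtraction on nat would give the wrong value. *)
definition binom :: "nat \<Rightarrow> int \<Rightarrow> rat" where
  "binom a b = (if b < 0 \<or> b > int a then 0 else of_nat (a choose nat b))"

definition narayana_poly2 :: "nat \<Rightarrow> nat \<Rightarrow> rat poly" where
  "narayana_poly2 n m =
     (\<Sum>k = 0..n. monom (binom n (int k) * binom m (int k)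
                        - binom n (int k + 1) * binom m (int k - 1)) k)"

definition narayana_poly :: "nat \<Rightarrow> nat \<Rightarrow> rat poly" where
  "narayana_poly t n = narayana_poly2 n (n + t)"

end

theory Submission
  imports Defs
begin

text \<open>The \<open>k\<close>-th coefficient of \<open>narayana_poly t n\<close> is a single hypergeometric term
  in \<open>n\<close> and \<open>k\<close>. Comparing coefficients therefore reduces the recurrence to an identity
  between polynomials in \<open>n\<close>, \<open>t\<close> and \<open>k\<close>, multiplied by one common product of reciprocal
  factorials. The boundary values of \<open>k\<close> need no separate treatment once the reciprocal
  factorial is extended by zero to the negative integers.\<close>

definition inv_fact :: "int \<Rightarrow> rat" where
  "inv_fact j = (if j < 0 then 0 else 1 / fact (nat j))"

text \<open>No sign condition is needed: at j = 0 the factor j produces the zero on the left, and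
  for negative j both sides vanish. This is what makes the boundary indices harmless.\<close>

lemma inv_fact_pred: "inv_fact (j - 1) = of_int j * inv_fact j"
proof (cases "j > 0")
  case True
  then obtain i where i: "j = int (Suc i)"
    by (metis gr0_implies_Suc zero_less_imp_eq_int)
  have "int (Suc i) - 1 = int i"
    by simp
  moreover have "(1 + of_nat i :: rat) \<noteq> 0"
    by (metis of_nat_Suc of_nat_0_eq_iff nat.distinct(1))
  ultimately show ?thesis
    unfolding i inv_fact_def nat_int fact_Suc by simp
next
  case False
  then show ?thesis
    by (cases "j = 0") (simp_all add: inv_fact_def)
qed

text \<open>When \<open>k\<close> lies outside 0..n, one of the two reciprocal factorials has a
  negative argument, which matches the convention in \<open>binom\<close>.\<close>

lemma binom_eq_inv_fact: "binom n k = fact n * inv_fact k * inv_fact (int n - k)"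
proof (cases "0 \<le> k \<and> k \<le> int n")
  case True
  then obtain i where "k = int i" "i \<le> n"
    by (metis nonneg_int_cases of_nat_le_iff)
  then show ?thesis
    by (simp add: binom_def inv_fact_def binomial_fact nat_diff_distrib)
next
  case False
  then show ?thesis
    by (auto simp: binom_def inv_fact_def)
qed

text \<open>The arguments of \<open>inv_fact\<close> are the largest ones in the two binomial
  products. Over this common factor the products leave (k+1)(n+t+1-k) and k(n-k), whose difference
  is the linear factor n+t+1+kt.\<close>

definition narayana_coeff :: "nat \<Rightarrow> nat \<Rightarrow> int \<Rightarrow> rat" where
  "narayana_coeff t n k = fact n * fact (n + t) * (of_nat (n + t + 1) + of_int k * of_nat t) *
     (inv_fact (k + 1) * inv_fact k * inv_fact (int n - k) * inv_fact (int (n + t + 1) - k))"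

lemma narayana_coeff_neg: "k < 0 \<Longrightarrow> narayana_coeff t n k = 0"
  by (simp add: narayana_coeff_def inv_fact_def)

lemma binom_diff_eq_narayana_coeff:
  "binom n k * binom (n + t) k - binom n (k + 1) * binom (n + t) (k - 1) = narayana_coeff t n k"
proof -
  have shifts:
    "inv_fact k = of_int (k + 1) * inv_fact (k + 1)"
    "inv_fact (k - 1) = of_int k * inv_fact k"
    "inv_fact (int n - (k + 1)) = of_int (int n - k) * inv_fact (int n - k)"
    "inv_fact (int (n + t) - k) = of_int (int (n + t + 1) - k) * inv_fact (int (n + t + 1) - k)"
    "int (n + t) - (k - 1) = int (n + t + 1) - k"
    using inv_fact_pred[of "k + 1"] inv_fact_pred[of k] inv_fact_pred[of "int n - k"]
      inv_fact_pred[of "int (n + t + 1) - k"]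
    by (simp_all add: algebra_simps)
  show ?thesis
    unfolding binom_eq_inv_fact narayana_coeff_def shifts(2-5)
    unfolding shifts(1) by (simp add: algebra_simps)
qed

lemma coeff_narayana_poly: "coeff (narayana_poly t n) k = narayana_coeff t n (int k)"
proof -
  have "coeff (narayana_poly t n) k =
      (if k \<le> n then narayana_coeff t n (int k) else 0)"
    unfolding narayana_poly_def narayana_poly2_def
    by (simp add: coeff_sum coeff_monom if_distrib binom_diff_eq_narayana_coeff cong: if_cong)
  \<comment> \<open>Beyond degree n the factor \<open>inv_fact (int n - k)\<close> is zero, so the
    case split disappears.\<close>
  then show ?thesis
    by (auto simp: narayana_coeff_def inv_fact_def)
qed

lemma inv_fact_diff_nat:
  "inv_fact (j - int d) = (\<Prod>i<d. of_int j - of_nat i) * inv_fact j"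
proof (induction d)
  case (Suc d)
  then show ?case
    using inv_fact_pred[of "j - int d"] by (simp add: algebra_simps)
qed simp

text \<open>For k < i the index on the right is negative and \<open>narayana_coeff\<close> is zero
  there, so one formula covers every k.\<close>

lemma coeff_monom_mult_narayana_poly:
  "coeff (monom c i * narayana_poly t n) k = c * narayana_coeff t n (int k - int i)"
  by (simp add: coeff_monom_mult coeff_narayana_poly narayana_coeff_neg of_nat_diff)

text \<open>Shifting the index by s lowers the first two arguments of \<open>inv_fact\<close> by s
  and the last two by d, measured from N. The remaining reciprocal factorials depend on N, t and k
  only, hence are shared by different rows n.\<close>

lemma narayana_coeff_shift:
  assumes "int n + int d + int s = N"
  shows "narayana_coeff t n (k - int s) =
    fact n * fact (n + t) * (of_nat (n + t + 1) + (of_int k - of_nat s) * of_nat t) *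
    ((\<Prod>i<s. of_int k + 1 - of_nat i) * (\<Prod>i<s. of_int k - of_nat i) *
    (\<Prod>i<d. of_int N - of_int k - of_nat i) *
    (\<Prod>i<d. of_int N + of_nat t + 1 - of_int k - of_nat i)) *
    (inv_fact (k + 1) * inv_fact k * inv_fact (N - k) * inv_fact (N + int t + 1 - k))"
proof -
  have args: "k - int s + 1 = k + 1 - int s"
    "int n - (k - int s) = N - k - int d"
    "int (n + t + 1) - (k - int s) = N + int t + 1 - k - int d"
    using assms by simp_all
  show ?thesis
    unfolding narayana_coeff_def args inv_fact_diff_nat by (simp add: mult_ac add_ac)
qed

text \<open>This compares coefficients of x^k after clearing denominators, with (x-1)^2 (b0 + b1 x)
  expanded as b0 + (b1 - 2 b0) x + (b0 - 2 b1) x^2 + b1 x^3.\<close>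

lemma narayana_coeff_recurrence:
  fixes t n :: nat and k :: int
  defines "\<tau> \<equiv> of_nat t :: rat" and "\<nu> \<equiv> of_nat n :: rat"
  defines "a0 \<equiv> - (2 * \<nu>^3 + (2 * \<tau> + 5) * \<nu>^2 + (2 * \<tau> + 3) * \<nu>)"
    and "a1 \<equiv> 2 * \<tau> * (\<tau> + 2) * \<nu>^3 + 3 * \<tau> * (\<tau> + 2)^2 * \<nu>^2
              + \<tau> * (\<tau> + 2) * (\<tau>^2 + 5 * \<tau> + 5) * \<nu>
              + 1/2 * \<tau> * (\<tau> + 1) * (\<tau> + 2) * (\<tau> + 3)"
    and "a2 \<equiv> (\<tau> + 1) * ((2 * \<tau> + 2) * \<nu>^3 + (3 * \<tau>^2 + 9 * \<tau> + 5) * \<nu>^2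
              + (2 * \<tau> + 3) * (\<tau>^2 + 3 * \<tau> + 1) * \<nu>
              + 1/2 * \<tau> * (\<tau> + 1) * (\<tau> + 2) * (\<tau> + 3))"
    and "b0 \<equiv> - (\<nu> + 1)"
    and "b1 \<equiv> (\<tau> + 1)^2 * \<nu> + 1/2 * (\<tau> + 1) * (\<tau>^2 + 4 * \<tau> + 2)"
    and "c0 \<equiv> - \<nu>"
    and "c1 \<equiv> (\<tau> + 1)^2 * \<nu> + 1/2 * \<tau> * (\<tau> + 1) * (\<tau> + 2)"
  assumes "n \<ge> 1"
  shows "(\<nu> + \<tau> + 3) * (\<nu> + 1) *
      (c0 * narayana_coeff t (n + 1) k + c1 * narayana_coeff t (n + 1) (k - 1)) =
    a0 * narayana_coeff t n k + a1 * narayana_coeff t n (k - 1) + a2 * narayana_coeff t n (k - 2) -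
    \<nu> * (\<nu> + \<tau>) *
      (b0 * narayana_coeff t (n - 1) k + (b1 - 2 * b0) * narayana_coeff t (n - 1) (k - 1) +
       (b0 - 2 * b1) * narayana_coeff t (n - 1) (k - 2) + b1 * narayana_coeff t (n - 1) (k - 3))"
proof -
  obtain p where n: "n = Suc p"
    using assms(10) by (cases n) auto
  define \<kappa> where "\<kappa> = (of_int k :: rat)"
  \<comment> \<open>The largest arguments of \<open>inv_fact\<close> among all the terms, so that each term is a
    polynomial multiple of \<open>U\<close>.\<close>
  define U where "U = fact p * fact (p + t) * (inv_fact (k + 1) * inv_fact k *
    inv_fact (int n + 2 - k) * inv_fact (int n + 2 + int t + 1 - k))"
  define \<mu> where "\<mu> = \<nu> + 2 - \<kappa>"
  define \<rho> where "\<rho> = \<nu> + \<tau> + 3 - \<kappa>"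
  have params: "of_nat t = \<tau>" "of_int k = \<kappa>" "of_int (int n + 2) - \<kappa> = \<mu>"
    "of_int (int n + 2) + \<tau> + 1 - \<kappa> = \<rho>"
    "of_nat (n + 1 + t + 1) = \<nu> + \<tau> + 2" "of_nat (n + t + 1) = \<nu> + \<tau> + 1"
    "of_nat (n - 1 + t + 1) = \<nu> + \<tau>"
    by (simp_all add: \<kappa>_def \<mu>_def \<rho>_def \<tau>_def \<nu>_def n)
  have facts: "fact n = \<nu> * fact p" "fact (n + t) = (\<nu> + \<tau>) * fact (p + t)"
    "fact (n + 1) = (\<nu> + 1) * \<nu> * fact p"
    "fact (n + 1 + t) = (\<nu> + \<tau> + 1) * (\<nu> + \<tau>) * fact (p + t)"
    "fact (n - 1) = (fact p :: rat)" "fact (n - 1 + t) = (fact (p + t) :: rat)"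
    by (simp_all add: n \<nu>_def \<tau>_def add_ac)
  have kappa_succ: "\<kappa> + 1 - 1 = \<kappa>" "\<kappa> + 1 - 2 = \<kappa> - 1" by simp_all
  \<comment> \<open>The rows n+1, n, n-1 occur with index shifts up to 1, 2, 3, so N = n+2 fits all
    of them, and d complements s to 1, 2, 3 respectively.\<close>
  have c20: "narayana_coeff t (n + 1) k =
      (\<nu> + 1) * \<nu> * (\<nu> + \<tau> + 1) * (\<nu> + \<tau>) * (\<nu> + \<tau> + 2 + \<kappa> * \<tau>) * \<mu> * \<rho> * U"
    using narayana_coeff_shift[of "n + 1" 1 0 "int n + 2" t k, unfolded params facts]
    by (simp add: n lessThan_nat_numeral lessThan_Suc U_def kappa_succ)
  have c21: "narayana_coeff t (n + 1) (k - 1) =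
      (\<nu> + 1) * \<nu> * (\<nu> + \<tau> + 1) * (\<nu> + \<tau>) * (\<nu> + \<tau> + 2 + (\<kappa> - 1) * \<tau>) * (\<kappa> + 1) * \<kappa> * U"
    using narayana_coeff_shift[of "n + 1" 0 1 "int n + 2" t k, unfolded params facts]
    by (simp add: n lessThan_nat_numeral lessThan_Suc U_def kappa_succ)
  have c10: "narayana_coeff t n k =
      \<nu> * (\<nu> + \<tau>) * (\<nu> + \<tau> + 1 + \<kappa> * \<tau>) * \<mu> * (\<mu> - 1) * \<rho> * (\<rho> - 1) * U"
    using narayana_coeff_shift[of n 2 0 "int n + 2" t k, unfolded params facts]
    by (simp add: n lessThan_nat_numeral lessThan_Suc U_def kappa_succ)
  have c11: "narayana_coeff t n (k - 1) =
      \<nu> * (\<nu> + \<tau>) * (\<nu> + \<tau> + 1 + (\<kappa> - 1) * \<tau>) * (\<kappa> + 1) * \<kappa> * \<mu> * \<rho> * U"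
    using narayana_coeff_shift[of n 1 1 "int n + 2" t k, unfolded params facts]
    by (simp add: n lessThan_nat_numeral lessThan_Suc U_def kappa_succ)
  have c12: "narayana_coeff t n (k - 2) =
      \<nu> * (\<nu> + \<tau>) * (\<nu> + \<tau> + 1 + (\<kappa> - 2) * \<tau>) * (\<kappa> + 1) * \<kappa> * \<kappa> * (\<kappa> - 1) * U"
    using narayana_coeff_shift[of n 0 2 "int n + 2" t k, unfolded params facts]
    by (simp add: n lessThan_nat_numeral lessThan_Suc U_def kappa_succ)
  have c00: "narayana_coeff t (n - 1) k =
      (\<nu> + \<tau> + \<kappa> * \<tau>) * \<mu> * (\<mu> - 1) * (\<mu> - 2) * \<rho> * (\<rho> - 1) * (\<rho> - 2) * U"
    using narayana_coeff_shift[of "n - 1" 3 0 "int n + 2" t k, unfolded params facts]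
    by (simp add: n lessThan_nat_numeral lessThan_Suc U_def kappa_succ)
  have c01: "narayana_coeff t (n - 1) (k - 1) =
      (\<nu> + \<tau> + (\<kappa> - 1) * \<tau>) * (\<kappa> + 1) * \<kappa> * \<mu> * (\<mu> - 1) * \<rho> * (\<rho> - 1) * U"
    using narayana_coeff_shift[of "n - 1" 2 1 "int n + 2" t k, unfolded params facts]
    by (simp add: n lessThan_nat_numeral lessThan_Suc U_def kappa_succ)
  have c02: "narayana_coeff t (n - 1) (k - 2) =
      (\<nu> + \<tau> + (\<kappa> - 2) * \<tau>) * (\<kappa> + 1) * \<kappa> * \<kappa> * (\<kappa> - 1) * \<mu> * \<rho> * U"
    using narayana_coeff_shift[of "n - 1" 1 2 "int n + 2" t k, unfolded params facts]
    by (simp add: n lessThan_nat_numeral lessThan_Suc U_def kappa_succ)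
  have c03: "narayana_coeff t (n - 1) (k - 3) =
      (\<nu> + \<tau> + (\<kappa> - 3) * \<tau>) * (\<kappa> + 1) * \<kappa> * (\<kappa> - 1) * \<kappa> * (\<kappa> - 1) * (\<kappa> - 2) * U"
    using narayana_coeff_shift[of "n - 1" 0 3 "int n + 2" t k, unfolded params facts]
    by (simp add: n lessThan_nat_numeral lessThan_Suc U_def kappa_succ)
  \<comment> \<open>Every term is now a polynomial in \<nu>, \<tau>, \<kappa> times
    \<open>U\<close>, and the claim is a polynomial identity.\<close>
  show ?thesis
    unfolding c20 c21 c10 c11 c12 c00 c01 c02 c03 a0_def a1_def a2_def b0_def b1_def c0_def c1_def
    \<mu>_def \<rho>_def
    by algebra
qed

text \<open>Passes from coefficients to the fraction field with all parameters symbolic, so the long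
  expressions for them never get expanded here. A nonzero constant term d c0 makes the denominator
  invertible.\<close>

lemma narayana_poly_recurrence:
  assumes "d \<noteq> 0" "c0 \<noteq> 0"
    and rec: "\<And>k. d * (c0 * narayana_coeff t l k + c1 * narayana_coeff t l (k - 1)) =
      a0 * narayana_coeff t m k + a1 * narayana_coeff t m (k - 1) + a2 * narayana_coeff t m (k - 2) -
      e * (b0 * narayana_coeff t n k + (b1 - 2 * b0) * narayana_coeff t n (k - 1) +
        (b0 - 2 * b1) * narayana_coeff t n (k - 2) + b1 * narayana_coeff t n (k - 3))"
  shows "to_fract (narayana_poly t l) =
    to_fract [:a0, a1, a2:] / to_fract (smult d [:c0, c1:]) * to_fract (narayana_poly t m) -
    to_fract (smult e ([:-1, 1:]^2 * [:b0, b1:])) / to_fract (smult d [:c0, c1:]) *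
      to_fract (narayana_poly t n)"
proof -
  have monoms:
    "smult d [:c0, c1:] = monom (d * c0) 0 + monom (d * c1) 1"
    "[:a0, a1, a2:] = monom a0 0 + monom a1 1 + monom a2 2"
    "smult e ([:-1, 1:]^2 * [:b0, b1:]) = monom (e * b0) 0 + monom (e * (b1 - 2 * b0)) 1 +
       monom (e * (b0 - 2 * b1)) 2 + monom (e * b1) 3"
    by (simp_all add: monom_Suc monom_0 numeral_2_eq_2 numeral_3_eq_3 algebra_simps)
  have "smult d [:c0, c1:] * narayana_poly t l = [:a0, a1, a2:] * narayana_poly t m -
      smult e ([:-1, 1:]^2 * [:b0, b1:]) * narayana_poly t n"
  proof (rule poly_eqI)
    fix k
    show "coeff (smult d [:c0, c1:] * narayana_poly t l) k =
      coeff ([:a0, a1, a2:] * narayana_poly t m -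
        smult e ([:-1, 1:]^2 * [:b0, b1:]) * narayana_poly t n) k"
      unfolding monoms distrib_right coeff_add coeff_diff coeff_monom_mult_narayana_poly
      using rec[of "int k"] by (simp add: algebra_simps)
  qed
  then have "to_fract (smult d [:c0, c1:]) * to_fract (narayana_poly t l) =
      to_fract [:a0, a1, a2:] * to_fract (narayana_poly t m) -
      to_fract (smult e ([:-1, 1:]^2 * [:b0, b1:])) * to_fract (narayana_poly t n)"
    by (metis to_fract_mult to_fract_diff)
  moreover have "to_fract (smult d [:c0, c1:]) \<noteq> 0"
    using assms by simp
  ultimately show ?thesis
    by (simp add: nonzero_eq_divide_eq flip: diff_divide_distrib) (simp only: mult.commute)
qed

(* The identity is stated in the fraction field of the polynomial ring over the rationals.
   The denominators are nonzero there, since c0 = -n and n \<ge> 1. *)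
theorem theorem4p3:
  fixes t n :: nat
  assumes "n \<ge> 1"
  shows
    "let \<tau> = of_nat t :: rat; \<nu> = of_nat n :: rat;
         a0 = - (2 * \<nu>^3 + (2 * \<tau> + 5) * \<nu>^2 + (2 * \<tau> + 3) * \<nu>);
         a1 = 2 * \<tau> * (\<tau> + 2) * \<nu>^3 + 3 * \<tau> * (\<tau> + 2)^2 * \<nu>^2
              + \<tau> * (\<tau> + 2) * (\<tau>^2 + 5 * \<tau> + 5) * \<nu>
              + 1/2 * \<tau> * (\<tau> + 1) * (\<tau> + 2) * (\<tau> + 3);
         a2 = (\<tau> + 1) * ((2 * \<tau> + 2) * \<nu>^3 + (3 * \<tau>^2 + 9 * \<tau> + 5) * \<nu>^2
              + (2 * \<tau> + 3) * (\<tau>^2 + 3 * \<tau> + 1) * \<nu>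
              + 1/2 * \<tau> * (\<tau> + 1) * (\<tau> + 2) * (\<tau> + 3));
         b0 = - (\<nu> + 1);
         b1 = (\<tau> + 1)^2 * \<nu> + 1/2 * (\<tau> + 1) * (\<tau>^2 + 4 * \<tau> + 2);
         c0 = - \<nu>;
         c1 = (\<tau> + 1)^2 * \<nu> + 1/2 * \<tau> * (\<tau> + 1) * (\<tau> + 2);
         den = smult ((\<nu> + \<tau> + 3) * (\<nu> + 1)) [:c0, c1:]
     in to_fract (narayana_poly t (n + 1)) =
          to_fract [:a0, a1, a2:] / to_fract den * to_fract (narayana_poly t n)
          - to_fract (smult (\<nu> * (\<nu> + \<tau>)) ([:-1, 1:]^2 * [:b0, b1:])) / to_fract den
            * to_fract (narayana_poly t (n - 1))"
  unfolding Let_def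
proof (rule narayana_poly_recurrence)
  show "(of_nat n + of_nat t + 3) * (of_nat n + 1) \<noteq> (0 :: rat)"
    by (metis of_nat_eq_0_iff of_nat_add of_nat_mult of_nat_numeral of_nat_1
        mult_eq_0_iff add_is_0 zero_neq_numeral zero_neq_one)
  show "- of_nat n \<noteq> (0 :: rat)"
    using assms by simp
qed (rule narayana_coeff_recurrence[OF assms])

end
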